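(* Let $\{w_k\}_{k\ge 0}$ be positive integers, let $v_0\in\mathbb{R}^n$, and let $\{v_k\}_{k\ge 0}$ be the sequence generated by risk-averse optimistic policy iteration: for each $k\ge 0$, $\pi_{k+1}\in\Pi$ is selected such that $D_{\pi_{k+1}}v_k=Dv_k$, and $$v_{k+1}=(D_{\pi_{k+1}})^{w_k}v_k .$$ Then, for any $v_0\in\mathbb{R}^n$, the sequence $\{v_k\}$ converges to $v^*$.
   Context: Setting. $\mathcal{S}=\{1,\dots,n\}$ and $\mathcal{A}=\{1,\dots,m\}$ are finite state and action sets, $\mathcal{A}(i)\subseteq\mathcal{A}$ is the nonempty set of actions allowed in state $i$, $\gamma\in(0,1)$ is the discount factor, $\mathbb{S}^n$ is the probability simplex in $\mathbb{R}^n$, $P:\mathcal{S}\times\mathcal{A}\to\mathbb{S}^n$ is the controlled kernel and $g:\mathcal{S}\times\mathcal{A}\to[-R,R]$, $R>0$, is the stage cost. $\Pi$ is the finite set of policies $\pi:\mathcal{S}\to\mathcal{A}$ with $\pi(i)\in\mathcal{A}(i)$ for all $i$. The risk-transition mapping $\chi:\mathbb{R}^n\times\mathbb{S}^n\to\mathbb{R}$ satisfies: for every $(i,a)$ there is a nonempty compact convex set $\mathcal{P}_\chi(P(i,a))\subset\mathbb{S}^n$ such that $\chi(v,P(i,a))=\max_{\tilde p\in\mathcal{P}_\chi(P(i,a))}\langle v,\tilde p\rangle$ for all $v\in\mathbb{R}^n$. The risk-averse Bellman operators $D_\pi,D:\mathbb{R}^n\to\mathbb{R}^n$ are $(D_\pi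 v)(i)=g(i,\pi(i))+\gamma\,\chi(v,P(i,\pi(i)))$ for $\pi\in\Pi$, and $(Dv)(i)=\min_{a\in\mathcal{A}(i)}\{g(i,a)+\gamma\,\chi(v,P(i,a))\}$, $i\in\mathcal{S}$. $D$ is a $\gamma$-contraction in the infinity norm, and $v^*$ denotes its unique fixed point. $(D_\pi)^w v$ denotes applying $D_\pi$ to $v$ successively $w$ times. *)

theory Defs
  imports "HOL-Analysis.Analysis"
begin

(* States are the elements of the finite type 'n, actions those of the finite type 'a. *)

definition prob_simplex :: "(real ^ 'n) set" where
  "prob_simplex = {p. (\<forall>i. 0 \<le> p $ i) \<and> (\<Sum>i\<in>UNIV. p $ i) = 1}"

definition policies :: "('n \<Rightarrow> 'a set) \<Rightarrow> ('n \<Rightarrow> 'a) set" where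
  "policies A = {\<pi>. \<forall>i. \<pi> i \<in> A i}"

(* x is an attained maximum; Max is not usable, since the sets in question are infinite. *)
definition is_maximum :: "real \<Rightarrow> real set \<Rightarrow> bool" where
  "is_maximum x S \<longleftrightarrow> x \<in> S \<and> (\<forall>y\<in>S. y \<le> x)"

(* chi is a total function, but only its values chi v p with p of the form P i a are
   constrained (and used); these p lie in prob_simplex. *)
definition risk_transition_mapping ::
    "('n \<Rightarrow> 'a \<Rightarrow> real ^ 'n) \<Rightarrow> (real ^ 'n \<Rightarrow> real ^ 'n \<Rightarrow> real) \<Rightarrow> bool" where
  "risk_transition_mapping P chi \<longleftrightarrow>
     (\<forall>i a. \<exists>Q. Q \<noteq> {} \<and> compact Q \<and> convex Q \<and> Q \<subseteq> prob_simplex \<and>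
        (\<forall>v. is_maximum (chi v (P i a)) ((\<lambda>q. v \<bullet> q) ` Q)))"

definition policy_operator ::
    "real \<Rightarrow> ('n \<Rightarrow> 'a \<Rightarrow> real) \<Rightarrow> ('n \<Rightarrow> 'a \<Rightarrow> real ^ 'n) \<Rightarrow>
     (real ^ 'n \<Rightarrow> real ^ 'n \<Rightarrow> real) \<Rightarrow> ('n \<Rightarrow> 'a) \<Rightarrow> real ^ 'n \<Rightarrow> real ^ 'n" where
  "policy_operator \<gamma> g P chi \<pi> v = (\<chi> i. g i (\<pi> i) + \<gamma> * chi v (P i (\<pi> i)))"

definition bellman_operator ::
    "real \<Rightarrow> ('n \<Rightarrow> 'a::finite set) \<Rightarrow> ('n \<Rightarrow> 'a \<Rightarrow> real) \<Rightarrow> ('n \<Rightarrow> 'a \<Rightarrow> real ^ 'n) \<Rightarrow>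
     (real ^ 'n \<Rightarrow> real ^ 'n \<Rightarrow> real) \<Rightarrow> real ^ 'n \<Rightarrow> real ^ 'n" where
  "bellman_operator \<gamma> A g P chi v = (\<chi> i. Min ((\<lambda>a. g i a + \<gamma> * chi v (P i a)) ` A i))"

(* For 0 < \<gamma> < 1 and nonempty A i the Bellman operator of a risk-transition mapping is a
   \<gamma>-contraction in the maximum norm, so exactly one fixed point exists. *)
definition optimal_value ::
    "real \<Rightarrow> ('n \<Rightarrow> 'a::finite set) \<Rightarrow> ('n \<Rightarrow> 'a \<Rightarrow> real) \<Rightarrow> ('n \<Rightarrow> 'a \<Rightarrow> real ^ 'n) \<Rightarrow>
     (real ^ 'n \<Rightarrow> real ^ 'n \<Rightarrow> real) \<Rightarrow> real ^ 'n" where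
  "optimal_value \<gamma> A g P chi = (THE v. bellman_operator \<gamma> A g P chi v = v)"

end

theory Submission
  imports Defs
begin

text \<open>
  Every operator \<open>F\<close> occurring here is monotone and, because the maximising weights lie in the
  probability simplex, turns a constant shift \<open>c\<close> of its argument into a shift \<open>\<gamma> c\<close>. Both facts
  together say that a one-sided bound \<open>u \<le> v + c\<close> is passed on as \<open>F u \<le> F v + \<gamma> c\<close>
  (\<open>discounts\<close>, established in \<open>discounts_policy_operator\<close> and
  \<open>discounts_bellman_operator\<close>). This and \<open>D u \<le> D\<^sub>\<pi> u\<close> drive the whole argument.

  Optimistic policy iteration is then controlled (\<open>optimistic_iteration_converges\<close>)
  by three one-sided bounds at \<open>v\<^sub>k\<close>, in which \<open>T\<close> is the operator of the greedy policy, so that \<open>T v\<^sub>k = D v\<^sub>k\<close>.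
  The residual bound \<open>D v\<^sub>k \<le> v\<^sub>k + c\<close> improves to \<open>\<gamma> c\<close>, since \<open>D \<le> T\<close> and applying
  \<open>T\<^sup>w\<close> to both sides of \<open>T v\<^sub>k \<le> v\<^sub>k + c\<close> gains \<open>\<gamma>\<^sup>w \<le> \<gamma>\<close>. The lower bound
  \<open>v\<^sup>* \<le> v\<^sub>k + d\<close> improves to \<open>\<gamma> d\<close>, again since \<open>D \<le> T\<close>. For the upper bound
  \<open>v\<^sub>k \<le> v\<^sup>* + e\<close>, the residuals of all inner iterations form a geometric series, whence
  \<open>T\<^sup>w v\<^sub>k \<le> D v\<^sub>k + \<gamma> c / (1 - \<gamma>)\<close> whatever \<open>w\<close> is, and \<open>e\<close> is replaced by
  \<open>\<gamma> e + \<gamma> c / (1 - \<gamma>)\<close>. As \<open>c\<close> is of order \<open>\<gamma>\<^sup>k\<close> at step \<open>k\<close>, the error is of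
  order \<open>k \<gamma>\<^sup>k\<close>, uniformly in the numbers of inner iterations. Some
  \<open>c \<ge> 0\<close> bounds the residual of any initial vector, so the argument does not have to start from
  \<open>D v\<^sub>0 \<le> v\<^sub>0\<close>.
\<close>

section \<open>Discounting operators\<close>

text \<open>
  With \<open>c = 0\<close> this is monotonicity; with \<open>c\<close> the maximum of \<open>\<bar>u - v\<bar>\<close>, used in both directions,
  it is the contraction property in the maximum norm.
\<close>
definition discounts :: "real \<Rightarrow> (real ^ 'n \<Rightarrow> real ^ 'n) \<Rightarrow> bool" where
  "discounts \<gamma> F \<longleftrightarrow>
     (\<forall>u v c. (\<forall>i. u $ i \<le> v $ i + c) \<longrightarrow> (\<forall>i. F u $ i \<le> F v $ i + \<gamma> * c))"

lemma discountsI: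
  assumes "\<And>u v c i. (\<And>j. u $ j \<le> v $ j + c) \<Longrightarrow> F u $ i \<le> F v $ i + \<gamma> * c"
  shows "discounts \<gamma> F"
  using assms unfolding discounts_def by blast

lemma discountsD:
  assumes "discounts \<gamma> F" "\<And>i. u $ i \<le> v $ i + c"
  shows "F u $ i \<le> F v $ i + \<gamma> * c"
  using assms unfolding discounts_def by blast

lemma discounts_funpow:
  assumes "discounts \<gamma> F"
  shows "discounts (\<gamma> ^ m) (F ^^ m)"
proof (induction m)
  case 0
  show ?case by (simp add: discounts_def)
next
  case (Suc m)
  show ?case
  proof (rule discountsI)
    fix u v :: "real ^ 'a" and c i
    assume "\<And>j. u $ j \<le> v $ j + c"
    then have "\<And>j. (F ^^ m) u $ j \<le> (F ^^ m) v $ j + \<gamma> ^ m * c"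
      by (rule discountsD[OF Suc])
    from discountsD[OF assms this]
    show "(F ^^ Suc m) u $ i \<le> (F ^^ Suc m) v $ i + \<gamma> ^ Suc m * c"
      by (simp add: mult.assoc)
  qed
qed

text \<open>
  Passing from the maximum norm to the Euclidean metric of \<open>real ^ 'n\<close> costs at most the factor
  \<open>CARD('n)\<close>.
\<close>
lemma discounts_dist_le:
  fixes F :: "real ^ 'n \<Rightarrow> real ^ 'n"
  assumes "discounts \<gamma> F"
  shows "dist (F u) (F v) \<le> real CARD('n) * \<gamma> * dist u v"
proof -
  have bound: "x $ i \<le> y $ i + dist x y" for x y :: "real ^ 'n" and i
    using component_le_norm_cart[of "x - y" i] by (simp add: dist_norm)
  have "\<bar>(F u - F v) $ i\<bar> \<le> \<gamma> * dist u v" for i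
    using discountsD[OF assms, of u v "dist u v" i] discountsD[OF assms, of v u "dist u v" i]
      bound[of u _ v] bound[of v _ u]
    by (simp add: dist_commute abs_le_iff)
  then have "(\<Sum>i\<in>UNIV. \<bar>(F u - F v) $ i\<bar>) \<le> (\<Sum>i\<in>(UNIV :: 'n set). \<gamma> * dist u v)"
    by (intro sum_mono)
  with norm_le_l1_cart[of "F u - F v"] show ?thesis
    by (simp add: dist_norm)
qed

text \<open>
  In the Euclidean metric \<open>F\<close> itself may fail to be a contraction, but a high power of \<open>F\<close> is one,
  and \<open>F\<close> maps the unique fixed point of that power to itself because the two commute.
\<close>
lemma discounts_ex1_fixed_point:
  fixes F :: "real ^ 'n \<Rightarrow> real ^ 'n"
  assumes "0 < \<gamma>" "\<gamma> < 1" "discounts \<gamma> F"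
  shows "\<exists>!x. F x = x"
proof -
  obtain m where m: "\<gamma> ^ m < 1 / real CARD('n)"
    using real_arch_pow_inv[of "1 / real CARD('n)" \<gamma>] assms by auto
  define q where "q = real CARD('n) * \<gamma> ^ m"
  have q: "0 \<le> q" "q < 1"
    using m assms by (auto simp: q_def field_simps)
  have "\<exists>!x. (F ^^ m) x = x"
    using q discounts_dist_le[OF discounts_funpow[OF assms(3), of m]]
    by (intro banach_fix_type) (auto simp: q_def)
  then obtain x where x: "(F ^^ m) x = x" and uniq: "\<And>y. (F ^^ m) y = y \<Longrightarrow> y = x"
    by auto
  have "(F ^^ m) (F x) = F x"
    using x by (metis funpow_swap1)
  then have "F x = x"
    by (rule uniq)
  moreover have "y = x" if "F y = y" for y
  proof (rule uniq)
    show "(F ^^ m) y = y" by (induction m) (simp_all add: that)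
  qed
  ultimately show ?thesis by blast
qed

section \<open>One-sided bounds along iterates\<close>

text \<open>
  The induction hypothesis reproduces itself because \<open>c / (1 - \<gamma>)\<close>, the sum of the geometric
  series \<open>c + \<gamma> c + \<gamma>\<^sup>2 c + \<dots>\<close>, satisfies \<open>b = c + \<gamma> b\<close>.
\<close>
lemma funpow_le_geometric:
  assumes "0 \<le> \<gamma>" "\<gamma> < 1" "0 \<le> c" "discounts \<gamma> T"
    and res: "\<And>i. T u $ i \<le> u $ i + c"
  shows "(T ^^ m) u $ i \<le> u $ i + c / (1 - \<gamma>)"
proof (induction m arbitrary: i)
  case 0
  show ?case using assms by simp
next
  case (Suc m)
  have "(T ^^ Suc m) u $ i \<le> T u $ i + \<gamma> * (c / (1 - \<gamma>))"
    using discountsD[OF \<open>discounts \<gamma> T\<close> Suc] by simp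
  also have "\<dots> \<le> u $ i + c + \<gamma> * (c / (1 - \<gamma>))"
    using res[of i] by simp
  also have "\<dots> = u $ i + c / (1 - \<gamma>)"
    using assms by (simp add: field_simps)
  finally show ?case .
qed

lemma funpow_ge_fixed_point:
  assumes "discounts \<gamma> D" "D x = x"
    and dom: "\<And>u i. D u $ i \<le> T u $ i"
    and "\<And>i. x $ i \<le> u $ i + d"
  shows "x $ i \<le> (T ^^ m) u $ i + \<gamma> ^ m * d"
proof (induction m arbitrary: i)
  case 0
  show ?case using assms by simp
next
  case (Suc m)
  have "x $ i \<le> D ((T ^^ m) u) $ i + \<gamma> * (\<gamma> ^ m * d)"
    using discountsD[OF \<open>discounts \<gamma> D\<close> Suc] \<open>D x = x\<close> by simp
  with dom[of "(T ^^ m) u" i] show ?case by (simp add: mult.assoc)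
qed

section \<open>Convergence of optimistic iteration\<close>

text \<open>
  The factor \<open>\<gamma> ^ w\<close> gained in each round is only exploited as \<open>\<gamma>\<close>, which is where \<open>w\<close> being
  positive enters; this makes all three bounds independent of the choice of \<open>w\<close>.
\<close>
lemma optimistic_iteration_converges:
  fixes D :: "real ^ 'n \<Rightarrow> real ^ 'n" and T :: "nat \<Rightarrow> real ^ 'n \<Rightarrow> real ^ 'n"
  assumes \<gamma>: "0 < \<gamma>" "\<gamma> < 1"
    and D: "discounts \<gamma> D" "D x = x"
    and T: "\<And>k. discounts \<gamma> (T k)" "\<And>k u i. D u $ i \<le> T k u $ i"
    and w: "\<And>k. 0 < w k"
    and greedy: "\<And>k. T k (v k) = D (v k)"
    and step: "\<And>k. v (Suc k) = (T k ^^ w k) (v k)"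
  shows "v \<longlonglongrightarrow> x"
proof -
  have bound: "a $ i \<le> b $ i + dist a b" for a b :: "real ^ 'n" and i
    using component_le_norm_cart[of "a - b" i] by (simp add: dist_norm)
  have pow_le: "\<gamma> ^ w k * b \<le> \<gamma> * b" if "0 \<le> b" for k b
    using power_decreasing[of 1 "w k" \<gamma>] \<gamma> w[of k] that
    by (intro mult_right_mono) auto
  define c where "c = dist (D (v 0)) (v 0)"
  define d where "d = dist x (v 0)"
  have nonneg: "0 \<le> \<gamma> ^ k * c" "0 \<le> \<gamma> ^ k * d" for k
    using \<gamma> by (simp_all add: c_def d_def)

  have residual: "D (v k) $ i \<le> v k $ i + \<gamma> ^ k * c" for k i
  proof (induction k arbitrary: i)
    case 0
    show ?case using bound by (simp add: c_def)
  next
    case (Suc k)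
    have "(T k ^^ w k) (T k (v k)) $ i \<le> (T k ^^ w k) (v k) $ i + \<gamma> ^ w k * (\<gamma> ^ k * c)"
      using discountsD[OF discounts_funpow[OF T(1)[of k], of "w k"], of "T k (v k)" "v k"] Suc
      by (simp add: greedy)
    then have "T k (v (Suc k)) $ i \<le> v (Suc k) $ i + \<gamma> ^ w k * (\<gamma> ^ k * c)"
      by (simp add: step funpow_swap1)
    with T(2)[of "v (Suc k)" i k] pow_le[OF nonneg(1), of k k] show ?case
      by (simp add: mult.assoc)
  qed

  have lower: "x $ i \<le> v k $ i + \<gamma> ^ k * d" for k i
  proof (induction k arbitrary: i)
    case 0
    show ?case using bound by (simp add: d_def)
  next
    case (Suc k)
    have "x $ i \<le> v (Suc k) $ i + \<gamma> ^ w k * (\<gamma> ^ k * d)"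
      unfolding step by (rule funpow_ge_fixed_point[OF D T(2) Suc])
    with pow_le[OF nonneg(2), of k k] show ?case
      by (simp add: mult.assoc)
  qed

  have upper: "v k $ i \<le> x $ i + \<gamma> ^ k * (d + real k * (c / (1 - \<gamma>)))" for k i
  proof (induction k arbitrary: i)
    case 0
    show ?case using bound[of "v 0" i x] by (simp add: d_def dist_commute)
  next
    case (Suc k)
    \<comment> \<open>The first of the \<open>w k\<close> inner steps is split off: it is a full step of \<open>D\<close>, which yields
      the factor \<open>\<gamma>\<close> in front of the old error.\<close>
    obtain m where m: "w k = Suc m"
      using w[of k] gr0_implies_Suc by blast
    have "(T k ^^ m) (v k) $ j \<le> v k $ j + \<gamma> ^ k * c / (1 - \<gamma>)" for j
      using \<gamma> nonneg(1) T(1) residual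
      by (intro funpow_le_geometric) (auto simp: greedy)
    from discountsD[OF T(1) this, of k i]
    have "v (Suc k) $ i \<le> D (v k) $ i + \<gamma> * (\<gamma> ^ k * c / (1 - \<gamma>))"
      by (simp add: step m greedy)
    moreover have "D (v k) $ i \<le> x $ i + \<gamma> * (\<gamma> ^ k * (d + real k * (c / (1 - \<gamma>))))"
      using discountsD[OF D(1) Suc] D(2) by simp
    ultimately show ?case
      by (simp add: algebra_simps add_divide_distrib)
  qed

  have pow0: "(\<lambda>k. \<gamma> ^ k) \<longlonglongrightarrow> 0"
    using \<gamma> by (intro LIMSEQ_realpow_zero) auto
  have npow0: "(\<lambda>k. real k * \<gamma> ^ k) \<longlonglongrightarrow> 0"
    using powser_times_n_limit_0[of \<gamma>] \<gamma> by simp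
  show ?thesis
  proof (rule vec_tendstoI)
    fix i
    have "(\<lambda>k. x $ i - \<gamma> ^ k * d) \<longlonglongrightarrow> x $ i - 0 * d"
      by (intro tendsto_intros pow0)
    moreover have "(\<lambda>k. x $ i + (\<gamma> ^ k * d + real k * \<gamma> ^ k * (c / (1 - \<gamma>))))
        \<longlonglongrightarrow> x $ i + (0 * d + 0 * (c / (1 - \<gamma>)))"
      by (intro tendsto_add tendsto_mult tendsto_const pow0 npow0)
    ultimately show "(\<lambda>k. v k $ i) \<longlonglongrightarrow> x $ i"
    proof (rule_tac tendsto_sandwich)
      show "\<forall>\<^sub>F k in sequentially. x $ i - \<gamma> ^ k * d \<le> v k $ i"
        using lower[of i] by (simp add: algebra_simps)
      show "\<forall>\<^sub>F k in sequentially. v k $ i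
          \<le> x $ i + (\<gamma> ^ k * d + real k * \<gamma> ^ k * (c / (1 - \<gamma>)))"
        using upper[of _ i] by (simp add: algebra_simps)
    qed simp_all
  qed
qed

section \<open>Risk-averse Bellman operators\<close>

text \<open>
  A maximiser \<open>q\<close> for \<open>u\<close> competes in the maximum for \<open>v\<close>, and as its weights are nonnegative
  with sum one, \<open>u \<bullet> q \<le> v \<bullet> q + c\<close>.
\<close>
lemma risk_transition_mapping_shift:
  fixes u v :: "real ^ 'n"
  assumes "risk_transition_mapping P chi" "\<And>i. u $ i \<le> v $ i + c"
  shows "chi u (P i a) \<le> chi v (P i a) + c"
proof -
  obtain Q where Q: "Q \<subseteq> prob_simplex"
    and max: "\<And>v. is_maximum (chi v (P i a)) ((\<lambda>q. v \<bullet> q) ` Q)"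
    using assms(1) unfolding risk_transition_mapping_def by metis
  obtain q where q: "q \<in> Q" "chi u (P i a) = u \<bullet> q"
    using max[of u] unfolding is_maximum_def by blast
  have simplex: "\<And>j. 0 \<le> q $ j" "(\<Sum>j\<in>UNIV. q $ j) = 1"
    using Q q(1) unfolding prob_simplex_def by auto
  have "u \<bullet> q \<le> (\<Sum>j\<in>UNIV. (v $ j + c) * q $ j)"
    unfolding inner_vec_def using simplex(1) assms(2)
    by (intro sum_mono) (simp add: mult_right_mono)
  also have "\<dots> = v \<bullet> q + c"
    using simplex(2)
    by (simp add: inner_vec_def distrib_right sum.distrib flip: sum_distrib_left)
  also have "v \<bullet> q \<le> chi v (P i a)"
    using max[of v] q(1) unfolding is_maximum_def by blast
  finally show ?thesis using q(2) by simp
qed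

lemma discounts_policy_operator:
  fixes P :: "'n::finite \<Rightarrow> 'a \<Rightarrow> real ^ 'n"
  assumes "0 \<le> \<gamma>" "risk_transition_mapping P chi"
  shows "discounts \<gamma> (policy_operator \<gamma> g P chi \<pi>)"
proof (rule discountsI)
  fix u v :: "real ^ 'n" and c i
  assume "\<And>j. u $ j \<le> v $ j + c"
  from mult_left_mono[OF risk_transition_mapping_shift[OF assms(2) this] assms(1)]
  show "policy_operator \<gamma> g P chi \<pi> u $ i \<le> policy_operator \<gamma> g P chi \<pi> v $ i + \<gamma> * c"
    by (simp add: policy_operator_def distrib_left)
qed

lemma bellman_operator_le:
  assumes "\<pi> \<in> policies A"
  shows "bellman_operator \<gamma> A g P chi u $ i \<le> policy_operator \<gamma> g P chi \<pi> u $ i"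
  using assms by (simp add: bellman_operator_def policy_operator_def policies_def)

lemma exists_greedy_policy:
  fixes A :: "'n::finite \<Rightarrow> 'a::finite set"
  assumes "\<And>i. A i \<noteq> {}"
  shows "\<exists>\<pi>\<in>policies A. policy_operator \<gamma> g P chi \<pi> v = bellman_operator \<gamma> A g P chi v"
proof -
  have "\<exists>a\<in>A i. Min ((\<lambda>a. g i a + \<gamma> * chi v (P i a)) ` A i) = g i a + \<gamma> * chi v (P i a)" for i
    using Min_in[of "(\<lambda>a. g i a + \<gamma> * chi v (P i a)) ` A i"] assms by fastforce
  then obtain \<pi> where "\<And>i. \<pi> i \<in> A i"
    "\<And>i. Min ((\<lambda>a. g i a + \<gamma> * chi v (P i a)) ` A i) = g i (\<pi> i) + \<gamma> * chi v (P i (\<pi> i))"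
    by metis
  then show ?thesis
    by (intro bexI[of _ \<pi>])
      (simp_all add: policies_def policy_operator_def bellman_operator_def)
qed

text \<open>
  A policy that is greedy for \<open>v\<close> is merely admissible for \<open>u\<close>, which is the right direction for
  an upper bound on \<open>D u\<close> in terms of \<open>D v\<close>.
\<close>
lemma discounts_bellman_operator:
  fixes A :: "'n::finite \<Rightarrow> 'a::finite set"
  assumes "0 \<le> \<gamma>" "\<And>i. A i \<noteq> {}" "risk_transition_mapping P chi"
  shows "discounts \<gamma> (bellman_operator \<gamma> A g P chi)"
proof (rule discountsI)
  fix u v :: "real ^ 'n" and c i
  assume le: "\<And>j. u $ j \<le> v $ j + c"
  obtain \<pi> where \<pi>: "\<pi> \<in> policies A"
    "policy_operator \<gamma> g P chi \<pi> v = bellman_operator \<gamma> A g P chi v"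
    using exists_greedy_policy[of A, OF assms(2)] by metis
  have "bellman_operator \<gamma> A g P chi u $ i \<le> policy_operator \<gamma> g P chi \<pi> u $ i"
    by (rule bellman_operator_le[OF \<pi>(1)])
  also have "\<dots> \<le> policy_operator \<gamma> g P chi \<pi> v $ i + \<gamma> * c"
    by (rule discountsD[OF discounts_policy_operator[OF assms(1,3)] le])
  finally show "bellman_operator \<gamma> A g P chi u $ i \<le> bellman_operator \<gamma> A g P chi v $ i + \<gamma> * c"
    by (simp add: \<pi>(2))
qed

theorem theorem7:
  fixes \<gamma> R :: real
    and A :: "'n::finite \<Rightarrow> 'a::finite set"
    and P :: "'n \<Rightarrow> 'a \<Rightarrow> real ^ 'n"
    and g :: "'n \<Rightarrow> 'a \<Rightarrow> real"
    and chi :: "real ^ 'n \<Rightarrow> real ^ 'n \<Rightarrow> real"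
    and w :: "nat \<Rightarrow> nat"
    and v0 :: "real ^ 'n"
    and v :: "nat \<Rightarrow> real ^ 'n"
    and \<pi> :: "nat \<Rightarrow> 'n \<Rightarrow> 'a"
  assumes "0 < \<gamma>" and "\<gamma> < 1"
    and "\<And>i. A i \<noteq> {}"
    and "\<And>i a. P i a \<in> prob_simplex"
    and "0 < R" and "\<And>i a. g i a \<in> {-R..R}"
    and "risk_transition_mapping P chi"
    and "\<And>k. 0 < w k"
    and "v 0 = v0"
    and "\<And>k. \<pi> (Suc k) \<in> policies A"
    and "\<And>k. policy_operator \<gamma> g P chi (\<pi> (Suc k)) (v k) = bellman_operator \<gamma> A g P chi (v k)"
    and "\<And>k. v (Suc k) = (policy_operator \<gamma> g P chi (\<pi> (Suc k)) ^^ w k) (v k)"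
  shows "v \<longlonglongrightarrow> optimal_value \<gamma> A g P chi"
proof -
  have D: "discounts \<gamma> (bellman_operator \<gamma> A g P chi)"
    using assms by (intro discounts_bellman_operator) auto
  have fixed: "bellman_operator \<gamma> A g P chi (optimal_value \<gamma> A g P chi)
      = optimal_value \<gamma> A g P chi"
    unfolding optimal_value_def
    by (rule theI'[OF discounts_ex1_fixed_point[OF \<open>0 < \<gamma>\<close> \<open>\<gamma> < 1\<close> D]])
  show ?thesis
  proof (rule optimistic_iteration_converges[OF \<open>0 < \<gamma>\<close> \<open>\<gamma> < 1\<close> D fixed])
    show "discounts \<gamma> (policy_operator \<gamma> g P chi (\<pi> (Suc k)))" for k
      using assms by (intro discounts_policy_operator) auto
    show "bellman_operator \<gamma> A g P chi u $ i \<le> policy_operator \<gamma> g P chi (\<pi> (Suc k)) u $ i"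
      for k u i
      by (rule bellman_operator_le[OF assms(10)])
  qed (rule assms)+
qed

end
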